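(* Let $\mu,\lambda,\alpha\in\mathbb{C}$ and let $V$ be an $\mathfrak a$-module such that for any $v\in V$ one has $L_mv=0$ for all but finitely many $m\ge -1$. Then the vector space $\mathcal{M}\big(V,\mu,\Omega(\lambda,\alpha)\big):=V\otimes\mathbb{C}[\partial]$ is a non-weight $\mathcal L$-module under the actions $$L_m\big(v\otimes f(\partial)\big)=v\otimes\lambda^m(\partial-m\alpha)f(\partial-m)+\Big(\big(\mu^me^{mt}-1\big)\frac{d}{dt}\,v\Big)\otimes\lambda^mf(\partial-m),\qquad C\big(v\otimes f(\partial)\big)=0$$ for $m\in\mathbb{Z}$, $v\in V$, $f(\partial)\in\mathbb{C}[\partial]$, where $\big(\mu^me^{mt}-1\big)\frac{d}{dt}\,v=\mu^m\sum_{i\ge 0}\frac{m^i}{i!}L_{i-1}v-L_{-1}v$.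
   Context: $\mathcal L$ is the Virasoro algebra: the complex Lie algebra with basis $\{L_m, C\mid m\in\mathbb{Z}\}$, where $L_m=t^{m+1}\frac{d}{dt}$, and brackets $[L_m,L_n]=(n-m)L_{m+n}+\delta_{m+n,0}\frac{m^3-m}{12}C$, $[L_m,C]=0$ for $m,n\in\mathbb{Z}$. $\mathfrak a=\mathrm{span}\{L_i\mid i\ge -1\}$ is a Lie subalgebra of $\mathcal L$. For $m\in\mathbb{Z}$, $e^{mt}=\sum_{i\ge 0}\frac{(mt)^i}{i!}\in\mathbb{C}[[t]]$, so that $e^{mt}\frac{d}{dt}=\sum_{i\ge 0}\frac{m^i}{i!}L_{i-1}$; applied to any $v\in V$ this is a finite sum by the assumption on $V$. $\mathbb{C}[\partial]$ is the polynomial algebra in the indeterminate $\partial$. $\Omega(\lambda,\alpha)=\mathbb{C}[\partial]$ denotes the $\mathcal L$-module with actions $L_mf(\partial)=\lambda^m(\partial-m\alpha)f(\partial-m)$ and $Cf(\partial)=0$ for $m\in\mathbb{Z}$, $f(\partial)\in\mathbb{C}[\partial]$. An $\mathcal L$-module is a weight module if $L_0$ and $C$ act diagonalizably on it, and non-weight otherwise. All vector spaces and tensor products are over $\mathbb{C}$.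
   Formalization: μ and λ are taken nonzero, since μ^m and λ^m for negative m are undefined at 0; "non-weight" is claimed only for V ≠ 0, since for V = 0 the module is zero and trivially a weight module. *)

theory Defs
  imports
    Complex_Main
    "HOL-Computational_Algebra.Polynomial"
    "HOL-Library.Groups_Big_Fun"
    "HOL-Library.Poly_Mapping"
begin

section \<open>Complex vector spaces\<close>

text \<open>
  A class rather than the locale \<open>vector_space\<close> alone, so that the scalar multiplication belongs
  to the type and the tensor product below can be a type constructor.
\<close>

class complex_vector = ab_group_add +
  fixes scaleC :: "complex \<Rightarrow> 'a \<Rightarrow> 'a"  (infixr \<open>*\<^sub>C\<close> 75)
  assumes scaleC_add_right: "a *\<^sub>C (x + y) = a *\<^sub>C x + a *\<^sub>C y"
    and scaleC_add_left: "(a + b) *\<^sub>C x = a *\<^sub>C x + b *\<^sub>C x"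
    and scaleC_scaleC: "a *\<^sub>C b *\<^sub>C x = (a * b) *\<^sub>C x"
    and scaleC_one: "1 *\<^sub>C x = x"

global_interpretation complex_vector: vector_space "scaleC :: complex \<Rightarrow> 'a \<Rightarrow> 'a::complex_vector"
  by unfold_locales (simp_all add: scaleC_add_right scaleC_add_left scaleC_scaleC scaleC_one)

instantiation complex :: complex_vector
begin
definition scaleC_complex :: "complex \<Rightarrow> complex \<Rightarrow> complex"
  where "scaleC_complex c x = c * x"
instance
  by standard (simp_all add: scaleC_complex_def algebra_simps)
end

instantiation poly :: (complex_vector) complex_vector
begin
definition scaleC_poly :: "complex \<Rightarrow> 'a poly \<Rightarrow> 'a poly"
  where "scaleC_poly c p = map_poly (scaleC c) p"
instance
  by standard
    (simp_all add: scaleC_poly_def poly_eq_iff coeff_map_poly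
      scaleC_add_right scaleC_add_left scaleC_scaleC scaleC_one)
end

lemma scaleC_poly_eq_smult: "c *\<^sub>C p = smult c p" for p :: "complex poly"
  by (simp add: poly_eq_iff scaleC_poly_def coeff_map_poly scaleC_complex_def)

instantiation poly_mapping :: (type, complex_vector) complex_vector
begin
definition scaleC_poly_mapping :: "complex \<Rightarrow> ('a \<Rightarrow>\<^sub>0 'b) \<Rightarrow> ('a \<Rightarrow>\<^sub>0 'b)"
  where "scaleC_poly_mapping c p = Poly_Mapping.map (scaleC c) p"

lemma lookup_scaleC: "Poly_Mapping.lookup (c *\<^sub>C p) k = c *\<^sub>C Poly_Mapping.lookup p k" for p :: "'a \<Rightarrow>\<^sub>0 'b"
  unfolding scaleC_poly_mapping_def by transfer (simp add: when_def)

instance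
  by standard
    (auto intro!: poly_mapping_eqI
      simp: lookup_scaleC lookup_add scaleC_add_right scaleC_add_left scaleC_scaleC scaleC_one)
end


section \<open>Tensor products over the complex numbers\<close>

text \<open>
  The free vector space on \<open>'a \<times> 'b\<close>, realised as the finitely supported functions, modulo the
  subspace generated by the bilinearity relations.
\<close>

definition tensor_relations ::
    "(('a::complex_vector \<times> 'b::complex_vector) \<Rightarrow>\<^sub>0 complex) set"
  where "tensor_relations = complex_vector.span
    (  {Poly_Mapping.single (x + x', y) 1 - Poly_Mapping.single (x, y) 1 - Poly_Mapping.single (x', y) 1 | x x' y. True}
     \<union> {Poly_Mapping.single (x, y + y') 1 - Poly_Mapping.single (x, y) 1 - Poly_Mapping.single (x, y') 1 | x y y'. True}
     \<union> {Poly_Mapping.single (c *\<^sub>C x, y) 1 - c *\<^sub>C Poly_Mapping.single (x, y) 1 | c x y. True}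
     \<union> {Poly_Mapping.single (x, c *\<^sub>C y) 1 - c *\<^sub>C Poly_Mapping.single (x, y) 1 | c x y. True})"

definition tensor_eq ::
    "(('a::complex_vector \<times> 'b::complex_vector) \<Rightarrow>\<^sub>0 complex) \<Rightarrow> ('a \<times> 'b \<Rightarrow>\<^sub>0 complex) \<Rightarrow> bool"
  where "tensor_eq p q \<longleftrightarrow> p - q \<in> tensor_relations"

lemma subspace_tensor_relations: "complex_vector.subspace tensor_relations"
  by (simp add: tensor_relations_def)

lemma equivp_tensor_eq: 
  "equivp (tensor_eq :: ('a::complex_vector \<times> 'b::complex_vector \<Rightarrow>\<^sub>0 complex) \<Rightarrow> _)" (is "equivp ?T")
proof (rule equivpI)
  show "reflp ?T"
    by (simp add: reflp_def tensor_eq_def complex_vector.subspace_0[OF subspace_tensor_relations])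
  show "symp ?T"
    unfolding symp_def tensor_eq_def
    by (metis complex_vector.subspace_neg[OF subspace_tensor_relations] minus_diff_eq)
  show "transp ?T"
    unfolding transp_def tensor_eq_def
  proof (intro allI impI)
    fix p q r :: "('a \<times> 'b) \<Rightarrow>\<^sub>0 complex"
    assume "p - q \<in> tensor_relations" "q - r \<in> tensor_relations"
    then have "(p - q) + (q - r) \<in> tensor_relations"
      by (rule complex_vector.subspace_add[OF subspace_tensor_relations])
    then show "p - r \<in> tensor_relations" by simp
  qed
qed

quotient_type (overloaded) ('a, 'b) tensor (infixr \<open>\<otimes>\<close> 81) =
  "('a::complex_vector \<times> 'b::complex_vector) \<Rightarrow>\<^sub>0 complex" / tensor_eq
  by (rule equivp_tensor_eq)

instantiation tensor :: (complex_vector, complex_vector) complex_vector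
begin

lift_definition zero_tensor :: "'a \<otimes> 'b" is 0 .

lift_definition plus_tensor :: "'a \<otimes> 'b \<Rightarrow> 'a \<otimes> 'b \<Rightarrow> 'a \<otimes> 'b" is "(+)"
  unfolding tensor_eq_def
  by (simp add: add_diff_add complex_vector.subspace_add[OF subspace_tensor_relations])

lift_definition uminus_tensor :: "'a \<otimes> 'b \<Rightarrow> 'a \<otimes> 'b" is "uminus"
  unfolding tensor_eq_def
  by (metis complex_vector.subspace_neg[OF subspace_tensor_relations] minus_diff_minus)

lift_definition minus_tensor :: "'a \<otimes> 'b \<Rightarrow> 'a \<otimes> 'b \<Rightarrow> 'a \<otimes> 'b" is "(-)"
  unfolding tensor_eq_def
proof -
  fix p q p' q' :: "('a \<times> 'b) \<Rightarrow>\<^sub>0 complex"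
  assume "p - q \<in> tensor_relations" "p' - q' \<in> tensor_relations"
  then have "(p - q) - (p' - q') \<in> tensor_relations"
    by (rule complex_vector.subspace_diff[OF subspace_tensor_relations])
  then show "p - p' - (q - q') \<in> tensor_relations" by (simp add: algebra_simps)
qed

lift_definition scaleC_tensor :: "complex \<Rightarrow> 'a \<otimes> 'b \<Rightarrow> 'a \<otimes> 'b" is "scaleC"
  unfolding tensor_eq_def
  by (simp add: complex_vector.subspace_scale[OF subspace_tensor_relations]
      flip: complex_vector.scale_right_diff_distrib)

instance
proof
  have *: "tensor_eq p p" for p :: "('a \<times> 'b) \<Rightarrow>\<^sub>0 complex"
    using equivp_tensor_eq by (rule equivp_reflp)
  fix a b c :: "'a \<otimes> 'b" and x y :: complex
  show "a + b + c = a + (b + c)" by transfer (simp add: * add.assoc)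
  show "a + b = b + a" by transfer (simp add: * add.commute)
  show "0 + a = a" by transfer (simp add: *)
  show "- a + a = 0" by transfer (simp add: *)
  show "a - b = a + - b" by transfer (simp add: *)
  show "x *\<^sub>C (a + b) = x *\<^sub>C a + x *\<^sub>C b" by transfer (simp add: * scaleC_add_right)
  show "(x + y) *\<^sub>C a = x *\<^sub>C a + y *\<^sub>C a" by transfer (simp add: * scaleC_add_left)
  show "x *\<^sub>C y *\<^sub>C a = (x * y) *\<^sub>C a" by transfer (simp add: *)
  show "1 *\<^sub>C a = a" by transfer (simp add: *)
qed

end

lift_definition tensor_prod :: "'a::complex_vector \<Rightarrow> 'b::complex_vector \<Rightarrow> 'a \<otimes> 'b"  (infixr \<open>\<otimes>\<^sub>t\<close> 75)
  is "\<lambda>x y. Poly_Mapping.single (x, y) 1" .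


section \<open>Lie algebras and their modules\<close>

locale lie_algebra =
  fixes G :: "'g::complex_vector set" and br :: "'g \<Rightarrow> 'g \<Rightarrow> 'g"
  assumes subspace_carrier: "complex_vector.subspace G"
    and br_closed: "\<lbrakk>x \<in> G; y \<in> G\<rbrakk> \<Longrightarrow> br x y \<in> G"
    and br_add_left: "\<lbrakk>x \<in> G; y \<in> G; z \<in> G\<rbrakk> \<Longrightarrow> br (x + y) z = br x z + br y z"
    and br_add_right: "\<lbrakk>x \<in> G; y \<in> G; z \<in> G\<rbrakk> \<Longrightarrow> br x (y + z) = br x y + br x z"
    and br_scale_left: "\<lbrakk>x \<in> G; y \<in> G\<rbrakk> \<Longrightarrow> br (c *\<^sub>C x) y = c *\<^sub>C br x y"
    and br_scale_right: "\<lbrakk>x \<in> G; y \<in> G\<rbrakk> \<Longrightarrow> br x (c *\<^sub>C y) = c *\<^sub>C br x y"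
    and br_self: "x \<in> G \<Longrightarrow> br x x = 0"
    and jacobi: "\<lbrakk>x \<in> G; y \<in> G; z \<in> G\<rbrakk> \<Longrightarrow> br x (br y z) + br y (br z x) + br z (br x y) = 0"

text \<open>
  The module is the whole type \<open>'v\<close>; the values of \<open>act\<close> outside \<open>G\<close> are irrelevant.
\<close>

locale lie_module = lie_algebra G br
  for G :: "'g::complex_vector set" and br :: "'g \<Rightarrow> 'g \<Rightarrow> 'g" +
  fixes act :: "'g \<Rightarrow> 'v::complex_vector \<Rightarrow> 'v"
  assumes act_linear: "x \<in> G \<Longrightarrow> Vector_Spaces.linear scaleC scaleC (act x)"
    and act_add_left: "\<lbrakk>x \<in> G; y \<in> G\<rbrakk> \<Longrightarrow> act (x + y) v = act x v + act y v"
    and act_scale_left: "x \<in> G \<Longrightarrow> act (c *\<^sub>C x) v = c *\<^sub>C act x v"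
    and act_br: "\<lbrakk>x \<in> G; y \<in> G\<rbrakk> \<Longrightarrow> act (br x y) v = act x (act y v) - act y (act x v)"

definition diagonalizable :: "('v::complex_vector \<Rightarrow> 'v) \<Rightarrow> bool"
  where "diagonalizable T \<longleftrightarrow>
    (\<exists>B. \<not> complex_vector.dependent B \<and> complex_vector.span B = UNIV \<and> (\<forall>b\<in>B. \<exists>c. T b = c *\<^sub>C b))"


section \<open>The Virasoro algebra\<close>

datatype vir_basis = Lgen int | Cgen

type_synonym vir = "vir_basis \<Rightarrow>\<^sub>0 complex"

definition vir_L :: "int \<Rightarrow> vir"
  where "vir_L m = Poly_Mapping.single (Lgen m) 1"

definition vir_C :: vir
  where "vir_C = Poly_Mapping.single Cgen 1"

fun vir_basis_bracket :: "vir_basis \<Rightarrow> vir_basis \<Rightarrow> vir"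
  where
    "vir_basis_bracket (Lgen m) (Lgen n) =
      of_int (n - m) *\<^sub>C vir_L (m + n) + (if m + n = 0 then (of_int (m ^ 3 - m) / 12) *\<^sub>C vir_C else 0)"
  | "vir_basis_bracket (Lgen m) Cgen = 0"
  | "vir_basis_bracket Cgen b = 0"

definition vir_bracket :: "vir \<Rightarrow> vir \<Rightarrow> vir"
  where "vir_bracket x y =
    (\<Sum>a\<in>Poly_Mapping.keys x. \<Sum>b\<in>Poly_Mapping.keys y.
      (Poly_Mapping.lookup x a * Poly_Mapping.lookup y b) *\<^sub>C vir_basis_bracket a b)"

definition vir_a :: "vir set"
  where "vir_a = complex_vector.span {vir_L i | i. i \<ge> -1}"

lemma vir_bracket_superset:
  assumes "finite A" "Poly_Mapping.keys x \<subseteq> A" "finite B" "Poly_Mapping.keys y \<subseteq> B"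
  shows "vir_bracket x y =
    (\<Sum>a\<in>A. \<Sum>b\<in>B. (Poly_Mapping.lookup x a * Poly_Mapping.lookup y b) *\<^sub>C vir_basis_bracket a b)"
proof -
  have "(\<Sum>b\<in>Poly_Mapping.keys y. (Poly_Mapping.lookup x a * Poly_Mapping.lookup y b) *\<^sub>C vir_basis_bracket a b)
      = (\<Sum>b\<in>B. (Poly_Mapping.lookup x a * Poly_Mapping.lookup y b) *\<^sub>C vir_basis_bracket a b)" for a
    using assms by (intro sum.mono_neutral_left) (auto simp: in_keys_iff)
  then have "vir_bracket x y = (\<Sum>a\<in>Poly_Mapping.keys x. \<Sum>b\<in>B.
      (Poly_Mapping.lookup x a * Poly_Mapping.lookup y b) *\<^sub>C vir_basis_bracket a b)"
    by (simp add: vir_bracket_def)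
  also have "\<dots> = (\<Sum>a\<in>A. \<Sum>b\<in>B. (Poly_Mapping.lookup x a * Poly_Mapping.lookup y b) *\<^sub>C vir_basis_bracket a b)"
    using assms by (intro sum.mono_neutral_left) (auto simp: in_keys_iff)
  finally show ?thesis .
qed

lemma vir_bracket_add_left: "vir_bracket (x + y) z = vir_bracket x z + vir_bracket y z"
proof -
  let ?A = "Poly_Mapping.keys x \<union> Poly_Mapping.keys y \<union> Poly_Mapping.keys (x + y)"
  show ?thesis
    by (subst (1 2 3) vir_bracket_superset[of ?A _ "Poly_Mapping.keys z"])
      (auto simp: lookup_add distrib_right scaleC_add_left sum.distrib)
qed

lemma vir_bracket_add_right: "vir_bracket z (x + y) = vir_bracket z x + vir_bracket z y"
proof -
  let ?A = "Poly_Mapping.keys x \<union> Poly_Mapping.keys y \<union> Poly_Mapping.keys (x + y)"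
  show ?thesis
    by (subst (1 2 3) vir_bracket_superset[of "Poly_Mapping.keys z" _ ?A])
      (auto simp: lookup_add distrib_left scaleC_add_left sum.distrib)
qed

lemma vir_bracket_scale_left: "vir_bracket (c *\<^sub>C x) y = c *\<^sub>C vir_bracket x y"
proof -
  let ?A = "Poly_Mapping.keys x \<union> Poly_Mapping.keys (c *\<^sub>C x)"
  show ?thesis
    by (subst (1 2) vir_bracket_superset[of ?A _ "Poly_Mapping.keys y"])
      (auto simp: lookup_scaleC scaleC_complex_def complex_vector.scale_sum_right mult.assoc)
qed

lemma vir_bracket_scale_right: "vir_bracket x (c *\<^sub>C y) = c *\<^sub>C vir_bracket x y"
proof -
  let ?A = "Poly_Mapping.keys y \<union> Poly_Mapping.keys (c *\<^sub>C y)"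
  show ?thesis
    by (subst (1 2) vir_bracket_superset[of "Poly_Mapping.keys x" _ ?A])
      (auto simp: lookup_scaleC scaleC_complex_def complex_vector.scale_sum_right mult_ac)
qed

lemma vir_bracket_zero [simp]: "vir_bracket 0 x = 0" "vir_bracket x 0 = 0"
  by (simp_all add: vir_bracket_def)

lemma vir_bracket_single:
  "vir_bracket (Poly_Mapping.single a 1) (Poly_Mapping.single b 1) = vir_basis_bracket a b"
  by (simp add: vir_bracket_def)

lemma vir_bracket_L_L:
  "vir_bracket (vir_L m) (vir_L n) =
    of_int (n - m) *\<^sub>C vir_L (m + n) + (if m + n = 0 then (of_int (m ^ 3 - m) / 12) *\<^sub>C vir_C else 0)"
  by (simp only: vir_L_def vir_bracket_single vir_basis_bracket.simps)

lemma vir_bracket_C [simp]: "vir_bracket (vir_L m) vir_C = 0" "vir_bracket vir_C (vir_L m) = 0"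
    "vir_bracket vir_C vir_C = 0"
  by (simp_all add: vir_L_def vir_C_def vir_bracket_single)

lemma vir_span: "x \<in> complex_vector.span (insert vir_C (range vir_L))"
proof -
  have *: "Poly_Mapping.single a 1 \<in> complex_vector.span (insert vir_C (range vir_L))" for a
    by (cases a) (auto intro!: complex_vector.span_base simp: vir_L_def vir_C_def)
  have "x = (\<Sum>a\<in>Poly_Mapping.keys x. Poly_Mapping.lookup x a *\<^sub>C Poly_Mapping.single a 1)"
    by (rule poly_mapping_eqI)
      (auto simp: lookup_sum lookup_scaleC scaleC_complex_def lookup_single when_def in_keys_iff
        if_distrib cong: if_cong)
  also have "\<dots> \<in> complex_vector.span (insert vir_C (range vir_L))"
    by (intro complex_vector.span_sum complex_vector.span_scale *)
  finally show ?thesis .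
qed

lemma vir_induct [case_names L C add scale]:
  assumes "\<And>m. P (vir_L m)" "P vir_C" "\<And>x y. P x \<Longrightarrow> P y \<Longrightarrow> P (x + y)" "\<And>c x. P x \<Longrightarrow> P (c *\<^sub>C x)"
  shows "P x"
proof -
  have "P (0 *\<^sub>C vir_C)" by (rule assms(4)[OF assms(2)])
  then have "complex_vector.subspace {x. P x}"
    using assms(3,4) by (simp add: complex_vector.subspace_def)
  moreover have "P x" if "x \<in> insert vir_C (range vir_L)" for x
    using that assms(1,2) by blast
  ultimately show ?thesis
    by (rule complex_vector.span_induct[OF vir_span])
qed

lemma vir_bracket_L_L_flip: "vir_bracket (vir_L m) (vir_L n) = - vir_bracket (vir_L n) (vir_L m)"
proof (cases "m + n = 0")
  case True
  then have n: "n = - m" by simp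
  have "(of_int (m ^ 3 - m) / 12) *\<^sub>C vir_C = - ((of_int ((- m) ^ 3 - - m) / 12) *\<^sub>C vir_C)"
    by (simp flip: complex_vector.scale_minus_left add: minus_divide_left)
  moreover have "of_int (- m - m) *\<^sub>C vir_L 0 = - (of_int (m - - m) *\<^sub>C vir_L 0)"
    by (simp flip: complex_vector.scale_minus_left)
  ultimately show ?thesis
    unfolding n vir_bracket_L_L by simp
next
  case False
  then show ?thesis
    by (simp add: vir_bracket_L_L add.commute[of n m] complex_vector.scale_left_diff_distrib)
qed

lemma vir_bracket_flip: "vir_bracket x y = - vir_bracket y x"
proof -
  note bilin = vir_bracket_add_left vir_bracket_add_right vir_bracket_scale_left vir_bracket_scale_right
  have flip_L: "vir_bracket (vir_L m) y = - vir_bracket y (vir_L m)" for m y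
  proof (induction y rule: vir_induct)
    case (L n) show ?case by (rule vir_bracket_L_L_flip)
  qed (simp_all add: bilin)
  have flip_C: "vir_bracket vir_C y = - vir_bracket y vir_C" for y
    by (induction y rule: vir_induct) (simp_all add: bilin)
  show ?thesis
  proof (induction x rule: vir_induct)
    case (L m) show ?case by (rule flip_L)
  next
    case C show ?case by (rule flip_C)
  qed (simp_all add: bilin)
qed

lemma vir_bracket_C_left [simp]: "vir_bracket vir_C x = 0"
  by (induction x rule: vir_induct) (simp_all add: vir_bracket_add_right vir_bracket_scale_right)

lemma vir_bracket_C_right [simp]: "vir_bracket x vir_C = 0"
  using vir_bracket_flip[of x vir_C] by simp

lemma vir_jacobi_L:
  "vir_bracket (vir_L l) (vir_bracket (vir_L m) (vir_L n)) + vir_bracket (vir_L m) (vir_bracket (vir_L n) (vir_L l))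
    + vir_bracket (vir_L n) (vir_bracket (vir_L l) (vir_L m)) = 0"
proof -
  have *: "vir_bracket (vir_L l) (vir_bracket (vir_L m) (vir_L n)) =
      of_int ((n - m) * (m + n - l)) *\<^sub>C vir_L (l + m + n)
      + (if l + m + n = 0 then (of_int ((n - m) * (l ^ 3 - l)) / 12) *\<^sub>C vir_C else 0)" for l m n
    by (auto simp: vir_bracket_L_L vir_bracket_add_right vir_bracket_scale_right scaleC_add_right
        add.assoc)
  have perm: "m + n + l = l + m + n" "n + l + m = l + m + n" by simp_all
  have 1: "of_int ((n - m) * (m + n - l)) *\<^sub>C vir_L (l + m + n)
      + of_int ((l - n) * (n + l - m)) *\<^sub>C vir_L (l + m + n)
      + of_int ((m - l) * (l + m - n)) *\<^sub>C vir_L (l + m + n) = 0"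
    unfolding scaleC_add_left[symmetric] of_int_add[symmetric]
    by (simp add: algebra_simps flip: of_int_mult)
  have 2: "(of_int ((n - m) * (l ^ 3 - l)) / 12) *\<^sub>C vir_C
      + (of_int ((l - n) * (m ^ 3 - m)) / 12) *\<^sub>C vir_C
      + (of_int ((m - l) * (n ^ 3 - n)) / 12) *\<^sub>C vir_C = 0" if "l + m + n = 0"
  proof -
    have l: "l = - m - n" using that by simp
    have "(n - m) * (l ^ 3 - l) + (l - n) * (m ^ 3 - m) + (m - l) * (n ^ 3 - n) = 0"
      unfolding l by (simp add: power3_eq_cube algebra_simps)
    then show ?thesis
      unfolding scaleC_add_left[symmetric] add_divide_distrib[symmetric] of_int_add[symmetric]
      by simp
  qed
  show ?thesis
    unfolding * perm using 1 2 by (auto simp: algebra_simps simp del: of_int_mult of_int_diff)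
qed

lemma vir_jacobi:
  "vir_bracket x (vir_bracket y z) + vir_bracket y (vir_bracket z x) + vir_bracket z (vir_bracket x y) = 0"
    (is "?J x y z = 0")
proof -
  note bilin = vir_bracket_add_left vir_bracket_add_right vir_bracket_scale_left vir_bracket_scale_right
  have J_add: "?J (x + x') y z = ?J x y z + ?J x' y z" for x x' y z by (simp add: bilin)
  have J_scale: "?J (c *\<^sub>C x) y z = c *\<^sub>C ?J x y z" for c x y z by (simp add: bilin scaleC_add_right)
  have rot: "?J x y z = ?J y z x" for x y z by (simp add: add_ac)
  have J_C: "?J vir_C y z = 0" for y z by simp
  have 1: "?J (vir_L l) (vir_L m) z = 0" for l m z
  proof -
    have "?J z (vir_L l) (vir_L m) = 0"
    proof (induction z rule: vir_induct)
      case (L n) show ?case by (rule vir_jacobi_L)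
    next
      case C show ?case by (rule J_C)
    next
      case (add x y) then show ?case unfolding J_add by simp
    next
      case (scale c x) then show ?case unfolding J_scale by simp
    qed
    then show ?thesis by (rule trans[OF rot[of z, symmetric]])
  qed
  have 2: "?J y z (vir_L l) = 0" for l y z
  proof (induction y rule: vir_induct)
    case (L m) show ?case by (rule trans[OF rot[symmetric] 1])
  next
    case C show ?case by (rule J_C)
  next
    case (add x y) then show ?case unfolding J_add by simp
  next
    case (scale c x) then show ?case unfolding J_scale by simp
  qed
  show ?thesis
  proof (induction x rule: vir_induct)
    case (L l) show ?case by (rule trans[OF rot 2])
  next
    case C show ?case by (rule J_C)
  next
    case (add x y) then show ?case unfolding J_add by simp
  next
    case (scale c x) then show ?case unfolding J_scale by simp
  qed
qed

lemma lie_algebra_vir: "lie_algebra UNIV vir_bracket"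
proof
  show "vir_bracket x x = 0" for x
  proof -
    have "vir_bracket x x + vir_bracket x x = 0"
      using vir_bracket_flip[of x x] by (metis add.right_inverse)
    then have "2 *\<^sub>C vir_bracket x x = 0"
      by (metis one_add_one scaleC_add_left scaleC_one)
    then show ?thesis by simp
  qed
qed (simp_all add: vir_bracket_add_left vir_bracket_add_right vir_bracket_scale_left
    vir_bracket_scale_right vir_jacobi)

lemma vir_bracket_L_in_a:
  assumes "i \<ge> -1" "j \<ge> -1" shows "vir_bracket (vir_L i) (vir_L j) \<in> vir_a"
proof -
  have "i \<in> {-1, 0, 1}" if "i + j = 0" using assms that by auto
  then have c: "vir_bracket (vir_L i) (vir_L j) = of_int (j - i) *\<^sub>C vir_L (i + j)"
    by (auto simp: vir_bracket_L_L)
  show ?thesis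
  proof (cases "i + j \<ge> -1")
    case True
    then show ?thesis unfolding c vir_a_def
      by (intro complex_vector.span_scale complex_vector.span_base) auto
  next
    case False
    then have "i = j" using assms by simp
    then show ?thesis by (subst c) (simp add: vir_a_def complex_vector.span_zero)
  qed
qed

lemma vir_bracket_in_a:
  assumes "x \<in> vir_a" "y \<in> vir_a" shows "vir_bracket x y \<in> vir_a"
proof -
  have sub: "complex_vector.subspace vir_a" by (simp add: vir_a_def)
  note closed = complex_vector.subspace_add[OF sub] complex_vector.subspace_scale[OF sub]
    complex_vector.subspace_0[OF sub]
  have 1: "vir_bracket (vir_L i) y \<in> vir_a" if "i \<ge> -1" for i
    using assms(2)[unfolded vir_a_def]
    by (rule complex_vector.span_induct)
      (auto simp: complex_vector.subspace_def vir_bracket_add_right vir_bracket_scale_right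
        closed vir_bracket_L_in_a that)
  show ?thesis
    using assms(1)[unfolded vir_a_def]
    by (rule complex_vector.span_induct)
      (auto simp: complex_vector.subspace_def vir_bracket_add_left vir_bracket_scale_left closed 1)
qed

lemma lie_algebra_vir_a: "lie_algebra vir_a vir_bracket"
proof
  show "complex_vector.subspace vir_a" by (simp add: vir_a_def)
  show "vir_bracket x x = 0" for x using lie_algebra.br_self[OF lie_algebra_vir] by simp
qed (simp_all add: vir_bracket_in_a vir_bracket_add_left vir_bracket_add_right vir_bracket_scale_left
    vir_bracket_scale_right vir_jacobi)

text \<open>
  For modules over the Virasoro algebra \<open>L\<^sub>0\<close> and \<open>C\<close> commute, so that requiring both to be
  diagonalizable is the same as requiring a common basis of eigenvectors.
\<close>

definition weight_module :: "(vir \<Rightarrow> 'v::complex_vector \<Rightarrow> 'v) \<Rightarrow> bool"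
  where "weight_module act \<longleftrightarrow> diagonalizable (act (vir_L 0)) \<and> diagonalizable (act vir_C)"

text \<open>
  The action of \<open>(\<mu>\<^sup>m e\<^sup>m\<^sup>t - 1) d/dt\<close> on a vector of a module over \<open>vir_a\<close>, where \<open>t\<^sup>i d/dt\<close> is \<open>L\<^sub>i\<^sub>-\<^sub>1\<close>.
  \<open>Sum_any\<close> adds up the nonzero terms and is \<open>0\<close> by convention if there are infinitely many of
  them, so the definition is meaningful only if almost all \<open>L\<^sub>i\<close> annihilate the vector.
\<close>

definition exp_field_act :: "(vir \<Rightarrow> 'v::complex_vector \<Rightarrow> 'v) \<Rightarrow> complex \<Rightarrow> int \<Rightarrow> 'v \<Rightarrow> 'v"
  where "exp_field_act act \<mu> m v =
    (\<mu> powi m) *\<^sub>C Sum_any (\<lambda>i::nat. (of_int m ^ i / fact i) *\<^sub>C act (vir_L (int i - 1)) v)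
      - act (vir_L (-1)) v"

text \<open>\<open>translate a f\<close> is \<open>f(\<partial> - a)\<close>.\<close>

definition translate :: "complex \<Rightarrow> complex poly \<Rightarrow> complex poly"
  where "translate a f = pcompose f [:- a, 1:]"

end

theory Submission
  imports Defs
begin

text \<open>
  Write \<open>X\<^sub>m = e\<^sup>m\<^sup>t d/dt\<close>, \<open>E\<^sub>m = \<mu>\<^sup>m X\<^sub>m - X\<^sub>0\<close>, and let \<open>B\<^sub>m f = \<lambda>\<^sup>m f(\<partial> - m)\<close>. Binomial expansion gives
  \<open>[X\<^sub>m, X\<^sub>n] = (n - m) X\<^sub>m\<^sub>+\<^sub>n\<close> on \<open>V\<close>, so \<open>E\<^sub>m\<close> fails to represent the centreless Virasoro algebra exactly by
  \<open>[E\<^sub>m, E\<^sub>n] = (n - m) E\<^sub>m\<^sub>+\<^sub>n + m E\<^sub>m - n E\<^sub>n\<close>; this defect is cancelled by the cross terms, which come from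
  the commutator of multiplication by \<open>\<partial>\<close> with \<open>B\<^sub>m\<close>. Since \<open>E\<^sub>0 = 0\<close>, the operator \<open>L\<^sub>0\<close> is \<open>1 \<otimes> \<partial>\<close>. Under
  the map \<open>V \<otimes> \<complex>[\<partial>] \<rightarrow> V[\<partial>]\<close> it becomes multiplication by \<open>\<partial>\<close>, which has no eigenvectors, so
  diagonalizability would force this map to vanish.
\<close>

subsection \<open>Linear maps on tensor products\<close>

abbreviation clinear :: "('a::complex_vector \<Rightarrow> 'b::complex_vector) \<Rightarrow> bool"
  where "clinear \<equiv> Vector_Spaces.linear scaleC scaleC"

lemma clinear_iff: "clinear f \<longleftrightarrow> (\<forall>x y. f (x + y) = f x + f y) \<and> (\<forall>c x. f (c *\<^sub>C x) = c *\<^sub>C f x)"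
  by (simp add: Vector_Spaces.linear_iff complex_vector.vector_space_axioms)

lemma clinear_add: "clinear f \<Longrightarrow> f (x + y) = f x + f y"
  and clinear_scale: "clinear f \<Longrightarrow> f (c *\<^sub>C x) = c *\<^sub>C f x"
  by (simp_all add: clinear_iff)

lemma clinear_0: "clinear f \<Longrightarrow> f 0 = 0"
  using clinear_scale[of f 0 0] by simp

lemma clinear_diff: "clinear f \<Longrightarrow> f (x - y) = f x - f y"
  using clinear_add[of f "x - y" y] by (simp add: algebra_simps)

lemma clinear_sum: "clinear f \<Longrightarrow> f (sum g A) = (\<Sum>a\<in>A. f (g a))"
  by (induction A rule: infinite_finite_induct) (simp_all add: clinear_0 clinear_add)

text \<open>The linear extension of \<open>g\<close> from the standard basis to the free vector
  space, a finite sum because keys are finite.\<close>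

definition free_extension :: "('k \<Rightarrow> 'w::complex_vector) \<Rightarrow> ('k \<Rightarrow>\<^sub>0 complex) \<Rightarrow> 'w"
  where "free_extension g p = (\<Sum>k\<in>Poly_Mapping.keys p. Poly_Mapping.lookup p k *\<^sub>C g k)"

lemma free_extension_superset:
  assumes "finite A" "Poly_Mapping.keys p \<subseteq> A"
  shows "free_extension g p = (\<Sum>k\<in>A. Poly_Mapping.lookup p k *\<^sub>C g k)"
  unfolding free_extension_def using assms
  by (intro sum.mono_neutral_left) (auto simp: in_keys_iff)

lemma free_extension_single [simp]: "free_extension g (Poly_Mapping.single k 1) = g k"
  by (simp add: free_extension_def scaleC_one)

lemma clinear_free_extension: "clinear (free_extension g)"
proof -
  have "free_extension g (p + q) = free_extension g p + free_extension g q" for p q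
  proof -
    let ?A = "Poly_Mapping.keys p \<union> Poly_Mapping.keys q \<union> Poly_Mapping.keys (p + q)"
    show ?thesis
      by (subst (1 2 3) free_extension_superset[of ?A])
        (auto simp: lookup_add scaleC_add_left sum.distrib)
  qed
  moreover have "free_extension g (c *\<^sub>C p) = c *\<^sub>C free_extension g p" for c p
  proof -
    let ?A = "Poly_Mapping.keys p \<union> Poly_Mapping.keys (c *\<^sub>C p)"
    show ?thesis
      by (subst (1 2) free_extension_superset[of ?A])
        (auto simp: lookup_scaleC scaleC_complex_def complex_vector.scale_sum_right)
  qed
  ultimately show ?thesis by (simp add: clinear_iff)
qed

lemma free_eq_sum_singles:
  "p = (\<Sum>k\<in>Poly_Mapping.keys p. Poly_Mapping.lookup p k *\<^sub>C Poly_Mapping.single k 1)"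
  for p :: "'k \<Rightarrow>\<^sub>0 complex"
  by (rule poly_mapping_eqI)
    (auto simp: lookup_sum lookup_scaleC scaleC_complex_def lookup_single when_def in_keys_iff
      if_distrib cong: if_cong)

section \<open>The universal property of the tensor product\<close>

lemma tensor_prod_add_left: "(x + x') \<otimes>\<^sub>t y = x \<otimes>\<^sub>t y + x' \<otimes>\<^sub>t y"
  by transfer (unfold tensor_eq_def tensor_relations_def diff_diff_eq[symmetric],
      rule complex_vector.span_base, blast)

lemma tensor_prod_add_right: "x \<otimes>\<^sub>t (y + y') = x \<otimes>\<^sub>t y + x \<otimes>\<^sub>t y'"
  by transfer (unfold tensor_eq_def tensor_relations_def diff_diff_eq[symmetric],
      rule complex_vector.span_base, blast)

lemma tensor_prod_scale_left: "(c *\<^sub>C x) \<otimes>\<^sub>t y = c *\<^sub>C (x \<otimes>\<^sub>t y)"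
  by transfer (unfold tensor_eq_def tensor_relations_def, rule complex_vector.span_base, blast)

lemma tensor_prod_scale_right: "x \<otimes>\<^sub>t (c *\<^sub>C y) = c *\<^sub>C (x \<otimes>\<^sub>t y)"
  by transfer (unfold tensor_eq_def tensor_relations_def, rule complex_vector.span_base, blast)

lemmas tensor_prod_bilinear =
  tensor_prod_add_left tensor_prod_add_right tensor_prod_scale_left tensor_prod_scale_right

lemma tensor_prod_diff_left: "(x - x') \<otimes>\<^sub>t y = x \<otimes>\<^sub>t y - x' \<otimes>\<^sub>t y"
  using tensor_prod_add_left[of "x - x'" x' y] by (simp add: algebra_simps)

lemma tensor_prod_zero_left [simp]: "0 \<otimes>\<^sub>t y = 0"
  using tensor_prod_diff_left[of 0 0 y] by simp

text \<open>A representative is a finite linear combination of basis elements of the free space, and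
  the class of each basis element is a pure tensor.\<close>

lemma tensor_induct [case_names prod add scale]:
  fixes w :: "'a::complex_vector \<otimes> 'b::complex_vector"
  assumes prod: "\<And>x y. P (x \<otimes>\<^sub>t y)"
    and add: "\<And>u w. P u \<Longrightarrow> P w \<Longrightarrow> P (u + w)"
    and scale: "\<And>c w. P w \<Longrightarrow> P (c *\<^sub>C w)"
  shows "P w"
proof (induction w rule: tensor.abs_induct)
  case (1 p)
  have zero: "P (0 :: 'a \<otimes> 'b)" using scale[OF prod, of 0] by simp
  have "P (abs_tensor (\<Sum>k\<in>A. c k *\<^sub>C Poly_Mapping.single k 1))" if "finite A"
    for A and c :: "'a \<times> 'b \<Rightarrow> complex"
    using that
  proof induction
    case empty
    then show ?case using zero by (simp add: zero_tensor_def)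
  next
    case (insert k A)
    have "P (c k *\<^sub>C (fst k \<otimes>\<^sub>t snd k))" by (intro scale prod)
    then have "P (abs_tensor (c k *\<^sub>C Poly_Mapping.single k 1))"
      by (simp add: tensor_prod.abs_eq scaleC_tensor.abs_eq)
    with insert show ?case
      by (simp add: add flip: plus_tensor.abs_eq)
  qed
  from this[of "Poly_Mapping.keys p" "Poly_Mapping.lookup p"] show ?case
    using free_eq_sum_singles[of p] by simp
qed

lemma clinear_tensor_ext:
  assumes "clinear f" "clinear g" "\<And>x y. f (x \<otimes>\<^sub>t y) = g (x \<otimes>\<^sub>t y)"
  shows "f w = g w"
  by (induction w rule: tensor_induct) (simp_all add: assms clinear_add clinear_scale)

text \<open>The free extension of a bilinear \<open>g\<close> kills the generators of
  \<open>tensor_relations\<close>, so it is constant on classes and descends to the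
  quotient.\<close>

lemma ex_tensor_lift:
  fixes g :: "'a::complex_vector \<Rightarrow> 'b::complex_vector \<Rightarrow> 'c::complex_vector"
  assumes left: "\<And>y. clinear (\<lambda>x. g x y)" and right: "\<And>x. clinear (g x)"
  shows "\<exists>h. clinear h \<and> (\<forall>x y. h (x \<otimes>\<^sub>t y) = g x y)"
proof -
  let ?F = "free_extension (case_prod g)"
  note lin = clinear_free_extension[of "case_prod g"]
  have ker: "complex_vector.subspace {p. ?F p = 0}"
    by (simp add: complex_vector.subspace_def clinear_0[OF lin] clinear_add[OF lin]
        clinear_scale[OF lin])
  \<comment> \<open>The kernel is a subspace, so only the four families of generators need
    checking.\<close>
  have F0: "?F p = 0" if "p \<in> tensor_relations" for p
    using that unfolding tensor_relations_def
  proof (rule complex_vector.span_induct[OF _ ker], elim UnE)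
  qed (auto simp: clinear_diff[OF lin] clinear_scale[OF lin]
      clinear_add[OF left] clinear_scale[OF left] clinear_add[OF right] clinear_scale[OF right])
  have F_cong: "?F p = ?F q" if "tensor_eq p q" for p q
    using F0[of "p - q"] that by (simp add: tensor_eq_def clinear_diff[OF lin])
  define h where "h w = ?F (rep_tensor w)" for w
  have h: "h (abs_tensor p) = ?F p" for p
    unfolding h_def
    by (rule F_cong) (metis Quotient3_tensor Quotient3_rep_abs equivp_reflp equivp_tensor_eq)
  have "h (u + w) = h u + h w" for u w
    by (induction u rule: tensor.abs_induct, induction w rule: tensor.abs_induct)
      (simp add: h plus_tensor.abs_eq clinear_add[OF lin])
  moreover have "h (c *\<^sub>C w) = c *\<^sub>C h w" for c w
    by (induction w rule: tensor.abs_induct) (simp add: h scaleC_tensor.abs_eq clinear_scale[OF lin])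
  moreover have "h (x \<otimes>\<^sub>t y) = g x y" for x y
    by (simp add: tensor_prod.abs_eq h)
  ultimately show ?thesis by (auto simp: clinear_iff)
qed

subsection \<open>Centreless modules over the Virasoro algebra\<close>

lemma vir_L_in_a: "i \<ge> -1 \<Longrightarrow> vir_L i \<in> vir_a"
  unfolding vir_a_def by (rule complex_vector.span_base) blast

text \<open>Extending \<open>T\<close> linearly with \<open>vir_C\<close> sent to 0 kills the
  central term of the bracket, so \<open>comm\<close> is the bracket relation on generators.
  Bilinearity then spreads it over the right argument and after that over the left one.\<close>

lemma ex_centreless_module:
  fixes T :: "int \<Rightarrow> 'w::complex_vector \<Rightarrow> 'w"
  assumes lin: "\<And>m. clinear (T m)"
    and comm: "\<And>m n w. T m (T n w) - T n (T m w) = of_int (n - m) *\<^sub>C T (m + n) w"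
  shows "\<exists>\<rho>. lie_module UNIV vir_bracket \<rho> \<and> (\<forall>m. \<rho> (vir_L m) = T m) \<and> \<rho> vir_C = (\<lambda>w. 0)"
proof -
  define \<rho> where "\<rho> x w = free_extension (\<lambda>b. case b of Lgen m \<Rightarrow> T m w | Cgen \<Rightarrow> 0) x" for x w
  have \<rho>_add: "\<rho> (x + y) w = \<rho> x w + \<rho> y w"
    and \<rho>_scale: "\<rho> (c *\<^sub>C x) w = c *\<^sub>C \<rho> x w" for x y c w
    by (simp_all add: \<rho>_def clinear_add[OF clinear_free_extension]
        clinear_scale[OF clinear_free_extension])
  have \<rho>_L: "\<rho> (vir_L m) = T m" for m by (simp add: \<rho>_def vir_L_def fun_eq_iff)
  have \<rho>_C: "\<rho> vir_C = (\<lambda>w. 0)" by (simp add: \<rho>_def vir_C_def fun_eq_iff)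
  have zero: "\<rho> 0 w = 0" for w by (simp add: \<rho>_def free_extension_def)
  have linear: "clinear (\<rho> x)" for x
  proof (induction x rule: vir_induct)
    case (L m) show ?case using \<rho>_L lin by simp
  next
    case C show ?case by (simp add: \<rho>_C clinear_iff)
  qed (auto simp: clinear_iff \<rho>_add \<rho>_scale scaleC_add_right mult.commute)
  have br_L_L: "\<rho> (vir_bracket (vir_L m) (vir_L n)) w = T m (T n w) - T n (T m w)" for m n w
    by (simp add: vir_bracket_L_L comm \<rho>_add \<rho>_scale \<rho>_L \<rho>_C zero)
  note bilin = vir_bracket_add_left vir_bracket_add_right vir_bracket_scale_left
    vir_bracket_scale_right
  have br_L: "\<rho> (vir_bracket (vir_L m) y) w = T m (\<rho> y w) - \<rho> y (T m w)" for m y w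
  proof (induction y rule: vir_induct)
    case (L n) show ?case by (simp add: br_L_L \<rho>_L)
  next
    case C show ?case by (simp add: \<rho>_C zero clinear_0[OF lin])
  next
    case (add x y) then show ?case by (simp add: bilin \<rho>_add clinear_add[OF lin])
  next
    case (scale c x) then show ?case
      by (simp add: bilin \<rho>_scale clinear_scale[OF lin]
          complex_vector.scale_right_diff_distrib)
  qed
  have br: "\<rho> (vir_bracket x y) w = \<rho> x (\<rho> y w) - \<rho> y (\<rho> x w)" for x y w
  proof (induction x rule: vir_induct)
    case (L m) show ?case by (simp add: br_L \<rho>_L)
  next
    case C show ?case by (simp add: \<rho>_C zero clinear_0[OF linear])
  next
    case (add x x') then show ?case by (simp add: bilin \<rho>_add clinear_add[OF linear])
  next
    case (scale c x) then show ?case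
      by (simp add: bilin \<rho>_scale clinear_scale[OF linear]
          complex_vector.scale_right_diff_distrib)
  qed
  have "lie_module UNIV vir_bracket \<rho>"
    by (intro lie_module.intro lie_module_axioms.intro lie_algebra_vir linear \<rho>_add \<rho>_scale br)
  then show ?thesis using \<rho>_L \<rho>_C by blast
qed

subsection \<open>Exponential vector fields\<close>

text \<open>Coefficient of t^k in e^(zt) e^(wt) = e^((z+w)t).\<close>

lemma exp_coeff_convolution:
  fixes z w :: complex
  shows "(\<Sum>i\<le>k. z ^ i / fact i * (w ^ (k - i) / fact (k - i))) = (z + w) ^ k / fact k"
  using exp_series_add_commuting[of z w k] by (simp add: scaleR_conv_of_real field_simps)

text \<open>Coefficient of t^k in e^(zt) (e^(wt))' - (e^(zt))' e^(wt) = (w - z) e^((z+w)t), the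
  bracket of two exponential vector fields.\<close>

lemma exp_coeff_convolution_diff:
  fixes z w :: complex
  shows "(\<Sum>i\<le>Suc k. z ^ i / fact i * (w ^ (Suc k - i) / fact (Suc k - i)) * (of_nat (Suc k - i) - of_nat i))
    = (w - z) * ((z + w) ^ k / fact k)"
proof -
  have step: "x ^ Suc j / fact (Suc j) * of_nat (Suc j) = x * (x ^ j / fact j)" for x :: complex and j
    by (simp add: field_simps del: of_nat_Suc)
  let ?a = "\<lambda>i. z ^ i / fact i" and ?b = "\<lambda>i. w ^ i / fact i"
  \<comment> \<open>The term \<open>i = Suc k\<close> carries the factor 0; in the mirror
    computation below it is the term \<open>i = 0\<close>.\<close>
  have "(\<Sum>i\<le>Suc k. ?a i * (?b (Suc k - i) * of_nat (Suc k - i)))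
      = (\<Sum>i\<le>k. ?a i * (?b (Suc (k - i)) * of_nat (Suc (k - i))))"
    by (simp add: Suc_diff_le del: of_nat_Suc of_nat_diff fact_Suc power_Suc)
  also have "\<dots> = w * ((z + w) ^ k / fact k)"
    unfolding step exp_coeff_convolution[symmetric] sum_distrib_left
    by (simp add: mult_ac)
  finally have 1: "(\<Sum>i\<le>Suc k. ?a i * (?b (Suc k - i) * of_nat (Suc k - i)))
      = w * ((z + w) ^ k / fact k)" .
  have "(\<Sum>i\<le>Suc k. (?a i * of_nat i) * ?b (Suc k - i))
      = (\<Sum>i\<le>k. (?a (Suc i) * of_nat (Suc i)) * ?b (k - i))"
    by (subst sum.atMost_Suc_shift) (simp del: of_nat_Suc fact_Suc power_Suc)
  also have "\<dots> = z * ((z + w) ^ k / fact k)"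
    unfolding step exp_coeff_convolution[symmetric] sum_distrib_left
    by (simp add: mult_ac)
  finally have 2: "(\<Sum>i\<le>Suc k. (?a i * of_nat i) * ?b (Suc k - i)) = z * ((z + w) ^ k / fact k)" .
  have "x * y * (b - a) = x * (y * b) - (x * a) * y" for x y a b :: complex
    by (simp add: algebra_simps)
  then show ?thesis
    unfolding left_diff_distrib 1[symmetric] 2[symmetric] sum_subtractf[symmetric]
    by (intro sum.cong refl)
qed

text \<open>
  Here \<open>l i\<close> stands for \<open>t\<^sup>i d/dt\<close>. The truncated \<open>i + j - 1\<close> is harmless because for \<open>i = j = 0\<close> the
  coefficient vanishes.
\<close>

locale locally_finite_witt =
  fixes l :: "nat \<Rightarrow> 'v::complex_vector \<Rightarrow> 'v"
  assumes linear: "clinear (l i)"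
    and loc_finite: "finite {i. l i v \<noteq> 0}"
    and commutator: "l i (l j v) - l j (l i v) = (of_nat j - of_nat i) *\<^sub>C l (i + j - 1) v"
begin

text \<open>The operator of e^(zt) d/dt. By \<open>loc_finite\<close> the default value of
  \<open>Sum_any\<close> for infinite support never occurs.\<close>

definition exp_act :: "complex \<Rightarrow> 'v \<Rightarrow> 'v"
  where "exp_act z v = Sum_any (\<lambda>i. (z ^ i / fact i) *\<^sub>C l i v)"

lemma exp_act_eq_sum:
  assumes "\<And>i. i \<ge> N \<Longrightarrow> l i v = 0"
  shows "exp_act z v = (\<Sum>i<N. (z ^ i / fact i) *\<^sub>C l i v)"
  unfolding exp_act_def
  by (rule Sum_any.expand_superset) (use assms in \<open>auto simp: not_less[symmetric]\<close>)

lemma ex_bound: "\<exists>N. \<forall>i\<ge>N. l i v = 0"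
  using loc_finite[of v] unfolding finite_nat_iff_bounded by (auto simp: subset_iff not_less[symmetric])

lemma exp_act_0 [simp]: "exp_act 0 v = l 0 v"
proof -
  obtain N where "\<forall>i\<ge>N. l i v = 0" using ex_bound by blast
  \<comment> \<open>The bound \<open>Suc N\<close> guarantees that the index 0, the only one that
    survives, lies in the range.\<close>
  then have "exp_act 0 v = (\<Sum>i<Suc N. (0 ^ i / fact i) *\<^sub>C l i v)"
    by (intro exp_act_eq_sum) simp
  also have "\<dots> = l 0 v"
    by (subst sum.lessThan_Suc_shift) (simp add: scaleC_one)
  finally show ?thesis .
qed

lemma clinear_exp_act: "clinear (exp_act z)"
proof -
  have "exp_act z (u + v) = exp_act z u + exp_act z v" for u v
  proof -
    obtain M N where M: "\<forall>i\<ge>M. l i u = 0" and N: "\<forall>i\<ge>N. l i v = 0" using ex_bound by meson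
    show ?thesis
      by (subst (1 2 3) exp_act_eq_sum[of "max M N"])
        (simp_all add: M N clinear_add[OF linear] scaleC_add_right sum.distrib)
  qed
  moreover have "exp_act z (c *\<^sub>C v) = c *\<^sub>C exp_act z v" for c v
  proof -
    obtain N where N: "\<forall>i\<ge>N. l i v = 0" using ex_bound by blast
    show ?thesis
      by (subst (1 2) exp_act_eq_sum[of N])
        (simp_all add: N clinear_scale[OF linear] complex_vector.scale_sum_right mult.commute)
  qed
  ultimately show ?thesis by (simp add: clinear_iff)
qed

text \<open>Only finitely many \<open>l j v\<close> are nonzero, so a single bound serves all of
  them. It truncates the double sums below uniformly in both indices.\<close>

lemma ex_bound2: "\<exists>M. (\<forall>i\<ge>M. l i v = 0) \<and> (\<forall>i j. i \<ge> M \<or> j \<ge> M \<longrightarrow> l i (l j v) = 0)"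
proof -
  obtain N where N: "\<forall>i\<ge>N. l i v = 0" using ex_bound by blast
  have "finite (\<Union>j<N. {i. l i (l j v) \<noteq> 0})" by (simp add: loc_finite)
  then obtain K where K: "\<And>i j. j < N \<Longrightarrow> i \<ge> K \<Longrightarrow> l i (l j v) = 0"
    unfolding finite_nat_iff_bounded by (auto simp: subset_iff not_less[symmetric])
  have "l i (l j v) = 0" if "i \<ge> max K N \<or> j \<ge> max K N" for i j
    using that K[of j i] N by (cases "j < N") (auto simp: clinear_0[OF linear])
  moreover have "\<forall>i\<ge>max K N. l i v = 0" using N by simp
  ultimately show ?thesis by blast
qed

text \<open>Both composites become sums over one finite index set; the commutator of
  \<open>l i\<close> and \<open>l j\<close> depends on its operator index only through
  \<open>i + j\<close>, so the sum is collected along antidiagonals and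
  \<open>exp_coeff_convolution_diff\<close> evaluates each.\<close>

lemma exp_act_commutator:
  "exp_act z (exp_act w v) - exp_act w (exp_act z v) = (w - z) *\<^sub>C exp_act (z + w) v"
proof -
  obtain M where M: "\<And>i j. i \<ge> M \<or> j \<ge> M \<Longrightarrow> l i (l j v) = 0" and Mv: "\<And>i. i \<ge> M \<Longrightarrow> l i v = 0"
    using ex_bound2[of v] by blast
  then have M': "l i (l j v) \<noteq> 0 \<Longrightarrow> i < M \<and> j < M" for i j by (meson leI)
  let ?e = "\<lambda>(z::complex) i. z ^ i / fact i"
  \<comment> \<open>The triangle contains the square of side \<open>M\<close> that supports the
    terms, is symmetric under swapping, and has the shape of
    \<open>sum.triangle_reindex\<close>.\<close>
  let ?T = "{(i, j). i + j < Suc (2 * M)}"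
  have fin: "finite ?T"
    by (rule finite_subset[of _ "{..2 * M} \<times> {..2 * M}"]) auto
  have comp: "exp_act z (exp_act w v) = (\<Sum>(i, j)\<in>?T. (?e z i * ?e w j) *\<^sub>C l i (l j v))" for z w
  proof -
    have w: "exp_act w v = (\<Sum>j<M. ?e w j *\<^sub>C l j v)"
      by (rule exp_act_eq_sum) (rule Mv)
    have "exp_act z (exp_act w v) = (\<Sum>i<M. ?e z i *\<^sub>C l i (exp_act w v))"
      by (rule exp_act_eq_sum)
        (simp add: w clinear_sum[OF linear] clinear_scale[OF linear] M)
    also have "\<dots> = (\<Sum>i<M. \<Sum>j<M. (?e z i * ?e w j) *\<^sub>C l i (l j v))"
      by (simp add: w clinear_sum[OF linear] clinear_scale[OF linear]
          complex_vector.scale_sum_right)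
    also have "\<dots> = (\<Sum>(i, j)\<in>{..<M} \<times> {..<M}. (?e z i * ?e w j) *\<^sub>C l i (l j v))"
      by (rule sum.cartesian_product)
    also have "\<dots> = (\<Sum>(i, j)\<in>?T. (?e z i * ?e w j) *\<^sub>C l i (l j v))"
      using fin by (intro sum.mono_neutral_left) (auto dest: M')
    finally show ?thesis .
  qed
  \<comment> \<open>Relabelling gives both composites the same coefficients, so they can be
    subtracted termwise.\<close>
  have swap: "(\<Sum>(i, j)\<in>?T. (?e w i * ?e z j) *\<^sub>C l i (l j v))
      = (\<Sum>(i, j)\<in>?T. (?e z i * ?e w j) *\<^sub>C l j (l i v))"
    by (rule sum.reindex_bij_witness[of _ prod.swap prod.swap]) (auto simp: add.commute mult.commute)
  have "exp_act z (exp_act w v) - exp_act w (exp_act z v)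
      = (\<Sum>(i, j)\<in>?T. (?e z i * ?e w j * (of_nat j - of_nat i)) *\<^sub>C l (i + j - 1) v)"
    unfolding comp swap sum_subtractf[symmetric]
    by (intro sum.cong)
      (auto simp: commutator simp flip: complex_vector.scale_right_diff_distrib)
  also have "\<dots> = (\<Sum>k<Suc (2 * M). \<Sum>i\<le>k.
      (?e z i * ?e w (k - i) * (of_nat (k - i) - of_nat i)) *\<^sub>C l (i + (k - i) - 1) v)"
    by (rule sum.triangle_reindex)
  also have "\<dots> = (\<Sum>k<Suc (2 * M).
      (\<Sum>i\<le>k. ?e z i * ?e w (k - i) * (of_nat (k - i) - of_nat i)) *\<^sub>C l (k - 1) v)"
    by (simp add: complex_vector.scale_sum_left)
  \<comment> \<open>The antidiagonal \<open>k = 0\<close> has coefficient 0; the others are shifted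
    down by one.\<close>
  also have "\<dots> = (\<Sum>k<2 * M. ((w - z) * ?e (z + w) k) *\<^sub>C l k v)"
    by (subst sum.lessThan_Suc_shift, unfold exp_coeff_convolution_diff) simp
  also have "\<dots> = (w - z) *\<^sub>C (\<Sum>k<2 * M. ?e (z + w) k *\<^sub>C l k v)"
    by (simp add: complex_vector.scale_sum_right)
  also have "(\<Sum>k<2 * M. ?e (z + w) k *\<^sub>C l k v) = exp_act (z + w) v"
    by (rule exp_act_eq_sum[symmetric]) (simp add: Mv)
  finally show ?thesis .
qed

end

lemma locally_finite_witt_of_module:
  fixes act :: "vir \<Rightarrow> 'v::complex_vector \<Rightarrow> 'v"
  assumes "lie_module vir_a vir_bracket act"
    and loc: "\<And>v. finite {m. m \<ge> -1 \<and> act (vir_L m) v \<noteq> 0}"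
  shows "locally_finite_witt (\<lambda>i. act (vir_L (int i - 1)))"
proof (rule locally_finite_witt.intro)
  interpret lie_module vir_a vir_bracket act by fact
  fix i j :: nat and v :: 'v
  show "clinear (act (vir_L (int i - 1)))"
    by (rule act_linear) (simp add: vir_L_in_a)
  \<comment> \<open>The index \<open>i\<close> of t^i d/dt corresponds to
    \<open>m = i - 1\<close>.\<close>
  have "finite ((\<lambda>m. nat (m + 1)) ` {m. m \<ge> -1 \<and> act (vir_L m) v \<noteq> 0})"
    by (intro finite_imageI loc)
  then show "finite {i. act (vir_L (int i - 1)) v \<noteq> 0}"
  proof (rule rev_finite_subset, intro subsetI)
    fix i assume "i \<in> {i. act (vir_L (int i - 1)) v \<noteq> 0}"
    then show "i \<in> (\<lambda>m. nat (m + 1)) ` {m. m \<ge> -1 \<and> act (vir_L m) v \<noteq> 0}"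
      by (intro image_eqI[of _ _ "int i - 1"]) auto
  qed
  show "act (vir_L (int i - 1)) (act (vir_L (int j - 1)) v)
      - act (vir_L (int j - 1)) (act (vir_L (int i - 1)) v)
      = (of_nat j - of_nat i) *\<^sub>C act (vir_L (int (i + j - 1) - 1)) v"
  proof (cases "i + j = 0")
    case False
    have idx: "int i - 1 + (int j - 1) = int (i + j - 1) - 1" using False by arith
    \<comment> \<open>The central term can occur only for \<open>i + j = 2\<close>, where m = i - 1
      is one of the roots -1, 0, 1 of m^3 - m.\<close>
    have central: "(int i - 1) ^ 3 - (int i - 1) = 0" if "int (i + j - 1) - 1 = 0"
    proof -
      have "i = 0 \<or> i = 1 \<or> i = 2" using that by arith
      then show ?thesis by auto
    qed
    have coeff: "(of_int (int j - 1 - (int i - 1)) :: complex) = of_nat j - of_nat i" by simp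
    have "vir_bracket (vir_L (int i - 1)) (vir_L (int j - 1))
        = (of_nat j - of_nat i) *\<^sub>C vir_L (int (i + j - 1) - 1)"
      unfolding vir_bracket_L_L idx coeff using central by (simp del: of_nat_diff)
    moreover have "vir_L (int (i + j - 1) - 1) \<in> vir_a" by (simp add: vir_L_in_a)
    ultimately show ?thesis
      using act_br[of "vir_L (int i - 1)" "vir_L (int j - 1)" v]
      by (simp add: vir_L_in_a act_scale_left)
  qed simp
qed

text \<open>In the commutator, [X_0, X_m] = m X_m produces the terms in X_m and X_n. On the
  right-hand side the X_0 contributions cancel, since -(n - m) - m + n = 0.\<close>

lemma exp_field_act_properties:
  fixes act :: "vir \<Rightarrow> 'v::complex_vector \<Rightarrow> 'v"
  assumes "lie_module vir_a vir_bracket act"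
    and "\<And>v. finite {m. m \<ge> -1 \<and> act (vir_L m) v \<noteq> 0}" and mu: "\<mu> \<noteq> 0"
  defines "E \<equiv> exp_field_act act \<mu>"
  shows clinear_exp_field_act: "clinear (E m)"
    and exp_field_act_0: "E 0 v = 0"
    and exp_field_act_commutator:
      "E m (E n v) - E n (E m v)
        = of_int (n - m) *\<^sub>C E (m + n) v + of_int m *\<^sub>C E m v - of_int n *\<^sub>C E n v"
proof -
  interpret locally_finite_witt "\<lambda>i. act (vir_L (int i - 1))"
    using assms by (intro locally_finite_witt_of_module)
  \<comment> \<open>Writing L_(-1) as \<open>exp_act 0\<close> puts both parts of E_m under the same
    commutator formula; hence \<open>exp_act_0\<close> is kept out of the simplifications
    below.\<close>
  have E: "E m v = \<mu> powi m *\<^sub>C exp_act (of_int m) v - exp_act 0 v" for m v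
    by (simp add: E_def exp_field_act_def exp_act_def[of "of_int m"])
  note lin = clinear_add[OF clinear_exp_act] clinear_scale[OF clinear_exp_act]
    clinear_diff[OF clinear_exp_act]
  show "clinear (E m)" for m
    by (simp add: clinear_iff E lin scaleC_add_right complex_vector.scale_right_diff_distrib
        mult.commute del: exp_act_0)
  show "E 0 v = 0" for v by (simp add: E scaleC_one)
  let ?X = "\<lambda>m. exp_act (of_int m)"
  have comm: "?X m (?X n v) = ?X n (?X m v) + of_int (n - m) *\<^sub>C ?X (m + n) v" for m n
    using exp_act_commutator[of "of_int m" "of_int n" v] by (simp add: algebra_simps)
  have comm0: "exp_act 0 (?X m v) = ?X m (exp_act 0 v) + of_int m *\<^sub>C ?X m v" for m
    using exp_act_commutator[of 0 "of_int m" v] by (simp add: algebra_simps del: exp_act_0)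
  have powi: "\<mu> powi (m + n) = \<mu> powi m * \<mu> powi n" by (simp add: mu power_int_add)
  show "E m (E n v) - E n (E m v)
      = of_int (n - m) *\<^sub>C E (m + n) v + of_int m *\<^sub>C E m v - of_int n *\<^sub>C E n v"
    unfolding E lin comm[of m n] comm0 powi
    by (simp add: scaleC_add_right complex_vector.scale_right_diff_distrib
        complex_vector.scale_left_diff_distrib algebra_simps del: exp_act_0)
qed

subsection \<open>The module structure on \<open>V \<otimes> \<complex>[\<partial>]\<close>\<close>

lemma translate_add [simp]: "translate a (f + g) = translate a f + translate a g"
  by (simp add: translate_def pcompose_add)

lemma translate_mult [simp]: "translate a (f * g) = translate a f * translate a g"
  by (simp add: translate_def pcompose_mult)

lemma translate_smult [simp]: "translate a (smult c f) = smult c (translate a f)"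
  by (simp add: translate_def pcompose_smult)

lemma translate_linear [simp]: "translate a [:b, 1:] = [:b - a, 1:]"
  by (simp add: translate_def pcompose_pCons)

lemma translate_translate [simp]: "translate a (translate b f) = translate (a + b) f"
  by (simp add: translate_def pcompose_assoc[symmetric] pcompose_pCons algebra_simps)

lemma translate_0 [simp]: "translate 0 f = f"
  by (simp add: translate_def pcompose_idR)

text \<open>The operators are 1 \<otimes> A_m + E_m \<otimes> B_m, with A the action on
  \<Omega>(\<lambda>,\<alpha>). By \<open>A_B\<close> the cross terms of the commutator are (n E_n -
  m E_m) \<otimes> B_(m+n), exactly cancelling the defect in \<open>comm\<close>.\<close>

lemma ex_tensor_twist_module:
  fixes E :: "int \<Rightarrow> 'v::complex_vector \<Rightarrow> 'v" and lam \<alpha> :: complex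
  assumes lin: "\<And>m. clinear (E m)" and lam: "lam \<noteq> 0"
    and comm: "\<And>m n v. E m (E n v) - E n (E m v)
      = of_int (n - m) *\<^sub>C E (m + n) v + of_int m *\<^sub>C E m v - of_int n *\<^sub>C E n v"
  shows "\<exists>\<rho>. lie_module UNIV vir_bracket \<rho> \<and>
    (\<forall>m v f. \<rho> (vir_L m) (v \<otimes>\<^sub>t f) =
        v \<otimes>\<^sub>t smult (lam powi m) ([:- (of_int m * \<alpha>), 1:] * translate (of_int m) f)
        + E m v \<otimes>\<^sub>t smult (lam powi m) (translate (of_int m) f)) \<and>
    \<rho> vir_C = (\<lambda>w. 0)"
proof -
  define B where "B m f = smult (lam powi m) (translate (of_int m) f)" for m f
  define A where "A m f = [:- (of_int m * \<alpha>), 1:] * B m f" for m f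
  have clinear_B: "clinear (B m)" for m
    by (simp add: clinear_iff B_def scaleC_poly_eq_smult smult_add_right mult.commute)
  have clinear_A: "clinear (A m)" for m
    unfolding clinear_iff A_def clinear_add[OF clinear_B] clinear_scale[OF clinear_B]
    unfolding scaleC_poly_eq_smult distrib_left mult_smult_right by blast
  have B_B: "B m (B n f) = B (m + n) f" for m n f
    by (simp add: B_def power_int_add lam)
  have B_A: "B m (A n f) = [:- (of_int n * \<alpha>) - of_int m, 1:] * B (m + n) f" for m n f
    unfolding A_def B_def
    by (simp add: power_int_add lam del: mult_pCons_left mult_pCons_right)
  have A_comm: "A m (A n f) - A n (A m f) = of_int (n - m) *\<^sub>C A (m + n) f" for m n f
    unfolding A_def[of m "A n f"] A_def[of n "A m f"] A_def[of "m + n"] B_A add.commute[of n m]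
      mult.assoc[symmetric] left_diff_distrib[symmetric] scaleC_poly_eq_smult
      mult_smult_left[symmetric]
    \<comment> \<open>With B_(m+n) f factored out, an identity between quadratic polynomials in
      \<partial> remains.\<close>
    by (rule arg_cong[where f = "\<lambda>p. p * B (m + n) f"]) (simp add: algebra_simps)
  have A_B: "A n (B m f) = B m (A n f) + of_int m *\<^sub>C B (m + n) f" for m n f
  proof -
    \<comment> \<open>The linear factors in A_n B_m and B_m A_n differ by the constant m, because
      B_m also shifts \<partial>.\<close>
    have "A n (B m f) = ([:- (of_int n * \<alpha>) - of_int m, 1:] + [:of_int m:]) * B (m + n) f"
      by (simp add: A_def B_B add.commute[of n m] del: mult_pCons_left)
    then show ?thesis
      unfolding B_A distrib_right scaleC_poly_eq_smult by simp
  qed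
  have "\<exists>T. clinear T \<and> (\<forall>v f. T (v \<otimes>\<^sub>t f) = v \<otimes>\<^sub>t A m f + E m v \<otimes>\<^sub>t B m f)" for m
    by (rule ex_tensor_lift)
      (simp_all add: clinear_iff tensor_prod_bilinear clinear_add[OF lin] clinear_scale[OF lin]
        clinear_add[OF clinear_A] clinear_scale[OF clinear_A]
        clinear_add[OF clinear_B] clinear_scale[OF clinear_B] scaleC_add_right)
  then obtain T where clinear_T: "\<And>m. clinear (T m)"
    and T: "\<And>m v f. T m (v \<otimes>\<^sub>t f) = v \<otimes>\<^sub>t A m f + E m v \<otimes>\<^sub>t B m f"
    by metis
  have T_comm: "T m (T n w) - T n (T m w) = of_int (n - m) *\<^sub>C T (m + n) w" for m n w
  proof (rule clinear_tensor_ext[where f = "\<lambda>w. T m (T n w) - T n (T m w)"])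
    show "clinear (\<lambda>w. T m (T n w) - T n (T m w))" "clinear (\<lambda>w. of_int (n - m) *\<^sub>C T (m + n) w)"
      by (simp_all add: clinear_iff clinear_add[OF clinear_T] clinear_scale[OF clinear_T]
          scaleC_add_right complex_vector.scale_right_diff_distrib mult.commute)
    fix v f
    have E_E: "E m (E n v) = E n (E m v) + of_int (n - m) *\<^sub>C E (m + n) v
        + of_int m *\<^sub>C E m v - of_int n *\<^sub>C E n v"
      using comm[of m n v] by (simp add: algebra_simps)
    have A_A: "A m (A n f) = A n (A m f) + of_int (n - m) *\<^sub>C A (m + n) f"
      using A_comm[of m n f] by (simp add: algebra_simps)
    show "T m (T n (v \<otimes>\<^sub>t f)) - T n (T m (v \<otimes>\<^sub>t f)) = of_int (n - m) *\<^sub>C T (m + n) (v \<otimes>\<^sub>t f)"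
      by (simp only: clinear_add[OF clinear_T] T A_B B_B E_E A_A add.commute[of n m]
          tensor_prod_bilinear tensor_prod_diff_left scaleC_add_right) (simp add: algebra_simps)
  qed
  obtain \<rho> where "lie_module UNIV vir_bracket \<rho>" "\<And>m. \<rho> (vir_L m) = T m" "\<rho> vir_C = (\<lambda>w. 0)"
    using ex_centreless_module[of T, OF clinear_T T_comm] by blast
  then show ?thesis
    by (intro exI[of _ \<rho>]) (simp add: T A_def B_def del: mult_pCons_left)
qed

text \<open>Passing to polynomials over V makes a degree available: multiplication by \<partial>
  raises it by one on nonzero elements, while a scalar cannot raise it.\<close>

lemma not_diagonalizable_id_tensor_mult:
  fixes T :: "'v::complex_vector \<otimes> complex poly \<Rightarrow> 'v \<otimes> complex poly"
  assumes "clinear T" and T: "\<And>v f. T (v \<otimes>\<^sub>t f) = v \<otimes>\<^sub>t ([:0, 1:] * f)"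
    and v: "(v :: 'v) \<noteq> 0"
  shows "\<not> diagonalizable T"
proof
  assume "diagonalizable T"
  then obtain D where span: "complex_vector.span D = UNIV" and eig: "\<forall>b\<in>D. \<exists>c. T b = c *\<^sub>C b"
    unfolding diagonalizable_def by blast
  obtain \<phi> :: "'v \<otimes> complex poly \<Rightarrow> 'v poly" where lin: "clinear \<phi>"
    and \<phi>: "\<And>v f. \<phi> (v \<otimes>\<^sub>t f) = map_poly (\<lambda>c. c *\<^sub>C v) f"
    using ex_tensor_lift[of "\<lambda>(v::'v) f. map_poly (\<lambda>c. c *\<^sub>C v) f"]
    by (auto simp: clinear_iff poly_eq_iff coeff_map_poly scaleC_poly_def scaleC_add_right
        scaleC_add_left scaleC_complex_def mult.commute)
  have pCons_scale: "pCons 0 (c *\<^sub>C p) = c *\<^sub>C pCons 0 p" for c and p :: "'v poly"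
    by (rule poly_eqI) (simp add: scaleC_poly_def coeff_map_poly coeff_pCons split: nat.split)
  have \<phi>_T: "\<phi> (T w) = pCons 0 (\<phi> w)" for w
  proof (rule clinear_tensor_ext[where f = "\<lambda>w. \<phi> (T w)"])
    show "clinear (\<lambda>w. \<phi> (T w))"
      unfolding clinear_iff
      by (simp add: clinear_add[OF assms(1)] clinear_scale[OF assms(1)] clinear_add[OF lin]
          clinear_scale[OF lin])
    show "clinear (\<lambda>w. pCons 0 (\<phi> w))"
      unfolding clinear_iff by (simp add: clinear_add[OF lin] clinear_scale[OF lin] pCons_scale)
    show "\<phi> (T (v \<otimes>\<^sub>t f)) = pCons 0 (\<phi> (v \<otimes>\<^sub>t f))" for v f
      by (simp add: T \<phi> map_poly_pCons)
  qed
  \<comment> \<open>Each eigenvector lies in the kernel of \<open>\<phi>\<close>; since the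
    eigenvectors span, \<open>\<phi>\<close> vanishes.\<close>
  have "\<phi> b = 0" if "b \<in> D" for b
  proof (rule ccontr)
    assume ne: "\<phi> b \<noteq> 0"
    from eig that obtain c where "T b = c *\<^sub>C b" by auto
    then have "pCons 0 (\<phi> b) = c *\<^sub>C \<phi> b" using \<phi>_T[of b] by (simp add: clinear_scale[OF lin])
    then have "Suc (degree (\<phi> b)) = degree (c *\<^sub>C \<phi> b)" using degree_pCons_eq[OF ne, of 0] by simp
    also have "\<dots> \<le> degree (\<phi> b)" 
      by (rule degree_le) (simp add: scaleC_poly_def coeff_map_poly coeff_eq_0)
    finally show False by simp
  qed
  moreover have "complex_vector.subspace {w. \<phi> w = 0}"
    by (simp add: complex_vector.subspace_def clinear_0[OF lin] clinear_add[OF lin]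
        clinear_scale[OF lin])
  ultimately have "\<phi> w = 0" for w
    using complex_vector.span_induct[of w D "\<lambda>w. \<phi> w = 0"] span by simp
  \<comment> \<open>\<open>\<phi>\<close> sends this tensor to the constant polynomial
    \<open>v\<close>, which is nonzero.\<close>
  from this[of "v \<otimes>\<^sub>t 1"] show False using v by (simp add: \<phi> scaleC_one one_pCons map_poly_pCons)
qed

text \<open>The formulas prescribe the action on pure tensors only, so the claim is that exactly one
  module structure extends them. Negative powers of \<mu> and \<lambda> occur, hence both are
  nonzero. The zero module is a weight module, hence the non-weight claim concerns V with a nonzero
  vector.\<close>

theorem proposition2p1:
  fixes \<mu> lam \<alpha> :: complex
    and act :: "vir \<Rightarrow> 'v::complex_vector \<Rightarrow> 'v"
  assumes mu: "\<mu> \<noteq> 0" and lam: "lam \<noteq> 0"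
    and module_V: "lie_module vir_a vir_bracket act"
    and locally_finite: "\<And>v. finite {m. m \<ge> -1 \<and> act (vir_L m) v \<noteq> 0}"
  shows "\<exists>!\<rho> :: vir \<Rightarrow> 'v \<otimes> complex poly \<Rightarrow> 'v \<otimes> complex poly.
    lie_module UNIV vir_bracket \<rho> \<and>
    (\<forall>m v f. \<rho> (vir_L m) (v \<otimes>\<^sub>t f) =
        v \<otimes>\<^sub>t smult (lam powi m) ([:- (of_int m * \<alpha>), 1:] * translate (of_int m) f)
        + exp_field_act act \<mu> m v \<otimes>\<^sub>t smult (lam powi m) (translate (of_int m) f)) \<and>
    (\<forall>v f. \<rho> vir_C (v \<otimes>\<^sub>t f) = 0) \<and>
    ((\<exists>v::'v. v \<noteq> 0) \<longrightarrow> \<not> weight_module \<rho>)"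
    (is "\<exists>!\<rho>. ?M \<rho> \<and> ?L \<rho> \<and> ?C \<rho> \<and> ?W \<rho>")
proof (rule ex_ex1I)
  note E = clinear_exp_field_act[OF module_V locally_finite mu]
    exp_field_act_0[OF module_V locally_finite mu]
    exp_field_act_commutator[OF module_V locally_finite mu]
  obtain \<rho> where M: "?M \<rho>" and L: "?L \<rho>" and C: "\<rho> vir_C = (\<lambda>w. 0)"
    using ex_tensor_twist_module[OF E(1) lam E(3), of \<alpha>] by blast
  \<comment> \<open>For m = 0 the scalar and the shift are trivial and E_0 = 0, so L_0 acts as 1
    \<otimes> \<partial>.\<close>
  have "\<not> diagonalizable (\<rho> (vir_L 0))" if "v \<noteq> 0" for v :: 'v
    using lie_module.act_linear[OF M UNIV_I] _ that
    by (rule not_diagonalizable_id_tensor_mult) (simp add: L E(2))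
  then have "?W \<rho>" by (auto simp: weight_module_def)
  then show "\<exists>\<rho>. ?M \<rho> \<and> ?L \<rho> \<and> ?C \<rho> \<and> ?W \<rho>" using M L C by auto
next
  fix \<rho> \<rho>'
  assume \<rho>: "?M \<rho> \<and> ?L \<rho> \<and> ?C \<rho> \<and> ?W \<rho>" and \<rho>': "?M \<rho>' \<and> ?L \<rho>' \<and> ?C \<rho>' \<and> ?W \<rho>'"
  interpret \<rho>: lie_module UNIV vir_bracket \<rho> by (rule conjunct1[OF \<rho>])
  interpret \<rho>': lie_module UNIV vir_bracket \<rho>' by (rule conjunct1[OF \<rho>'])
  have gen_L: "\<rho> (vir_L m) (v \<otimes>\<^sub>t f) = \<rho>' (vir_L m) (v \<otimes>\<^sub>t f)" for m v f
    using conjunct1[OF conjunct2[OF \<rho>]] conjunct1[OF conjunct2[OF \<rho>']]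
    by (elim allE[of _ m] allE[of _ v] allE[of _ f]) (rule trans[OF _ sym])
  have gen_C: "\<rho> vir_C (v \<otimes>\<^sub>t f) = \<rho>' vir_C (v \<otimes>\<^sub>t f)" for v f
    using \<rho> \<rho>' by metis
  note eqI = clinear_tensor_ext[OF \<rho>.act_linear[OF UNIV_I] \<rho>'.act_linear[OF UNIV_I]]
  \<comment> \<open>Agreement on pure tensors gives equal operators for each L_m and for C;
    linearity in the Lie algebra element does the rest.\<close>
  have "\<rho> x w = \<rho>' x w" for x w
  proof (induction x rule: vir_induct)
    case (L m)
    show ?case by (rule eqI) (rule gen_L)
  next
    case C
    show ?case by (rule eqI) (rule gen_C)
  next
    case (add x y)
    then show ?case by (simp only: \<rho>.act_add_left \<rho>'.act_add_left UNIV_I)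
  next
    case (scale c x)
    then show ?case by (simp only: \<rho>.act_scale_left \<rho>'.act_scale_left UNIV_I)
  qed
  then show "\<rho> = \<rho>'" by (intro ext)
qed

end
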